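(* Let $0\le\alpha<1$ and let $f(z)=zh(z)\overline{g(z)}\in ST_{Lh}(0)$ be logharmonic with respect to $a\in B$. Let $$K(z)=z\exp\left(2\operatorname{Re}\int_0^z\frac{a(s)}{1-a(s)}\,\frac{ds}{s}\right).$$ Then $$F(z)=f(z)^{1-\alpha}\,K(z)^{\alpha}\in ST_{Lh}(\alpha).$$
   Context: Let $U=\{z\in\mathbb{C}:|z|<1\}$, let $H(U)$ be the space of analytic functions on $U$, and let $B$ be the set of $a\in H(U)$ with $|a(z)|<1$ in $U$. A logharmonic mapping on $U$ with respect to $a\in B$ is a solution $f$ of $$\frac{\overline{f_{\overline z}}}{\overline f}=a\,\frac{f_z}{f}.$$ For $0\le\alpha<1$, $ST_{Lh}(\alpha)$ (starlike logharmonic mappings of order $\alpha$) is the set of all univalent logharmonic mappings on $U$ (with respect to some $a\in B$) of the form $f(z)=zh(z)\overline{g(z)}$, where $h,g\in H(U)$ are nonvanishing, $g(0)=1$, such that $$\operatorname{Re}\frac{zf_z-\overline z f_{\overline z}}{f}>\alpha\quad\text{for all } z\in U .$$ The form $f=zh\overline g$ forces $a(0)=0$, so the integral defining $K$ makes sense. Writing $K(z)=z\,k(z)\overline{k(z)}$ with $k(z)=\exp\int_0^z\frac{a(s)}{(1-a(s))s}ds$, the powers are understood through analytic branches of powers of the nonvanishing functions $h,g,k$, i.e. $F(z)=z\,\bigl(h(z)^{1-\alpha}k(z)^{\alpha}\bigr)\overline{\bigl(g(z)^{1-\alpha}k(z)^{\alpha}\bigr)}$, with the branches of powers of $g$ and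 $k$ equal to $1$ at $0$. *)

theory Defs
  imports "HOL-Complex_Analysis.Complex_Analysis"
begin

abbreviation unit_disc :: "complex set" where
  "unit_disc \<equiv> ball 0 1"

definition dilatations :: "(complex \<Rightarrow> complex) set" where
  "dilatations = {a. a holomorphic_on unit_disc \<and> (\<forall>z\<in>unit_disc. cmod (a z) < 1)}"

definition wirtinger :: "(complex \<Rightarrow> complex) \<Rightarrow> complex \<Rightarrow> complex" where
  "wirtinger f z =
     (frechet_derivative f (at z) 1 - \<i> * frechet_derivative f (at z) \<i>) / 2"

definition wirtinger_bar :: "(complex \<Rightarrow> complex) \<Rightarrow> complex \<Rightarrow> complex" where
  "wirtinger_bar f z =
     (frechet_derivative f (at z) 1 + \<i> * frechet_derivative f (at z) \<i>) / 2"

text \<open>Differentiability is over the reals. The equation contains quotients by \<open>f\<close>, so it is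
  imposed where \<open>f\<close> does not vanish.\<close>

definition logharmonic :: "(complex \<Rightarrow> complex) \<Rightarrow> (complex \<Rightarrow> complex) \<Rightarrow> bool" where
  "logharmonic a f \<longleftrightarrow>
     (\<forall>z\<in>unit_disc. f differentiable (at z)) \<and>
     (\<forall>z\<in>unit_disc. f z \<noteq> 0 \<longrightarrow>
        cnj (wirtinger_bar f z) / cnj (f z) = a z * (wirtinger f z / f z))"

definition lh_factorization ::
    "(complex \<Rightarrow> complex) \<Rightarrow> (complex \<Rightarrow> complex) \<Rightarrow> (complex \<Rightarrow> complex) \<Rightarrow> bool" where
  "lh_factorization f h g \<longleftrightarrow>
     h holomorphic_on unit_disc \<and> g holomorphic_on unit_disc \<and>
     (\<forall>z\<in>unit_disc. h z \<noteq> 0 \<and> g z \<noteq> 0) \<and> g 0 = 1 \<and>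
     (\<forall>z\<in>unit_disc. f z = z * h z * cnj (g z))"

text \<open>For \<open>f z = z * h z * cnj (g z)\<close> the quotient in the last condition extends continuously to
  the origin with value \<open>1\<close>, so for \<open>\<alpha> < 1\<close> the origin, where the quotient has
  the form \<open>0 / 0\<close>, imposes no condition.\<close>

definition ST_Lh :: "real \<Rightarrow> (complex \<Rightarrow> complex) set" where
  "ST_Lh \<alpha> = {f.
     inj_on f unit_disc \<and>
     (\<exists>a\<in>dilatations. logharmonic a f) \<and>
     (\<exists>h g. lh_factorization f h g) \<and>
     (\<forall>z\<in>unit_disc - {0}. \<alpha> < Re ((z * wirtinger f z - cnj z * wirtinger_bar f z) / f z))}"

text \<open>The integrand has a removable singularity at \<open>0\<close> when \<open>a 0 = 0\<close>; its value at that
  point does not affect the integral.\<close>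

definition lh_integral :: "(complex \<Rightarrow> complex) \<Rightarrow> complex \<Rightarrow> complex" where
  "lh_integral a z = contour_integral (linepath 0 z) (\<lambda>s. a s / ((1 - a s) * s))"

definition lh_k :: "(complex \<Rightarrow> complex) \<Rightarrow> complex \<Rightarrow> complex" where
  "lh_k a z = exp (lh_integral a z)"

definition lh_K :: "(complex \<Rightarrow> complex) \<Rightarrow> complex \<Rightarrow> complex" where
  "lh_K a z = z * of_real (exp (2 * Re (lh_integral a z)))"

definition power_branch ::
    "real \<Rightarrow> (complex \<Rightarrow> complex) \<Rightarrow> (complex \<Rightarrow> complex) \<Rightarrow> bool" where
  "power_branch \<beta> u p \<longleftrightarrow>
     (\<exists>L. L holomorphic_on unit_disc \<and>
        (\<forall>z\<in>unit_disc. exp (L z) = u z \<and> p z = exp (of_real \<beta> * L z)))"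

text \<open>\<open>F\<close> is \<open>f\<close> to the power \<open>1 - \<alpha>\<close> times \<open>K\<close> to the power \<open>\<alpha>\<close>, for
  \<open>f z = z * h z * cnj (g z)\<close> and \<open>K z = z * k z * cnj (k z)\<close>. The branch of the power of \<open>h\<close> is
  arbitrary; those of \<open>g\<close> and \<open>k\<close> are normalised at \<open>0\<close>.\<close>

definition power_product ::
    "real \<Rightarrow> (complex \<Rightarrow> complex) \<Rightarrow> (complex \<Rightarrow> complex) \<Rightarrow> (complex \<Rightarrow> complex) \<Rightarrow>
     (complex \<Rightarrow> complex) \<Rightarrow> (complex \<Rightarrow> complex) \<Rightarrow> (complex \<Rightarrow> complex) \<Rightarrow> bool" where
  "power_product \<alpha> f h g K k F \<longleftrightarrow>
     lh_factorization f h g \<and> lh_factorization K k k \<and>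
     (\<exists>p q r. power_branch (1 - \<alpha>) h p \<and>
        power_branch (1 - \<alpha>) g q \<and> q 0 = 1 \<and>
        power_branch \<alpha> k r \<and> r 0 = 1 \<and>
        (\<forall>z\<in>unit_disc. F z = z * (p z * r z) * cnj (q z * r z)))"

text \<open>The remaining facts show that these notions are not vacuous: \<open>lh_K a\<close> factors through
  \<open>lh_k a\<close>, the power product exists, and its values are values of the multivalued power.\<close>

lemma lh_integral_holomorphic:
  assumes a: "a \<in> dilatations" and a0: "a 0 = 0"
  shows "lh_integral a holomorphic_on unit_disc"
proof -
  define q where "q = (\<lambda>z. if z = 0 then deriv a 0 else a z / z)"
  have hol: "a holomorphic_on unit_disc" and lt: "\<And>z. z \<in> unit_disc \<Longrightarrow> cmod (a z) < 1"
    using a by (auto simp: dilatations_def)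
  have q: "q holomorphic_on unit_disc"
    by (rule pole_theorem_open_0[OF hol, of 0]) (auto simp: q_def a0)
  have ne: "1 - a z \<noteq> 0" if "z \<in> unit_disc" for z
    using lt[OF that] by auto
  have "(\<lambda>z. q z / (1 - a z)) holomorphic_on unit_disc"
    by (intro holomorphic_intros q hol ne)
  then obtain G where G: "\<And>x. x \<in> unit_disc \<Longrightarrow>
      (G has_field_derivative q x / (1 - a x)) (at x within unit_disc)"
    using holomorphic_convex_primitive'[of unit_disc] by auto
  have eq: "lh_integral a z = G z - G 0" if z: "z \<in> unit_disc" for z
  proof (cases "z = 0")
    case True
    then show ?thesis by (simp add: lh_integral_def)
  next
    case False
    have sub: "path_image (linepath 0 z) \<subseteq> unit_disc"
      using z closed_segment_subset[of 0 unit_disc z] by simp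
    have "lh_integral a z = contour_integral (linepath 0 z) (\<lambda>s. q s / (1 - a s))"
      unfolding lh_integral_def
      by (rule contour_integral_spike_finite_simple_path[of "{0}"])
         (use False in \<open>auto simp: q_def mult.commute\<close>)
    also have "\<dots> = G z - G 0"
      using contour_integral_primitive[OF G _ sub] by (simp add: contour_integral_unique)
    finally show ?thesis .
  qed
  have "(\<lambda>z. G z - G 0) holomorphic_on unit_disc"
    using G by (intro holomorphic_intros)
      (unfold holomorphic_on_def field_differentiable_def, blast)
  then show ?thesis
    by (rule holomorphic_transform) (simp only: eq)
qed

lemma lh_K_factorization:
  assumes "a \<in> dilatations" and "a 0 = 0"
  shows "lh_factorization (lh_K a) (lh_k a) (lh_k a)"
proof -
  have "lh_k a = (\<lambda>z. exp (lh_integral a z))"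
    by (auto simp: lh_k_def)
  then have "lh_k a holomorphic_on unit_disc"
    using lh_integral_holomorphic[OF assms] by (auto intro!: holomorphic_intros)
  moreover have "lh_k a 0 = 1"
    by (simp add: lh_k_def lh_integral_def)
  moreover have "lh_K a z = z * lh_k a z * cnj (lh_k a z)" for z
    unfolding lh_K_def lh_k_def exp_cnj mult.assoc exp_add[symmetric] complex_add_cnj
    by (simp add: exp_of_real[symmetric])
  ultimately show ?thesis
    by (simp add: lh_factorization_def lh_k_def)
qed

lemma power_branch_exists:
  assumes "u holomorphic_on unit_disc" and "\<And>z. z \<in> unit_disc \<Longrightarrow> u z \<noteq> 0"
  shows "\<exists>p. power_branch \<beta> u p \<and> (u 0 = 1 \<longrightarrow> p 0 = 1)"
proof -
  obtain L where L: "L holomorphic_on unit_disc" "\<And>z. z \<in> unit_disc \<Longrightarrow> u z = exp (L z)"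
    using contractible_imp_holomorphic_log[OF assms(1) convex_imp_contractible[OF convex_ball]]
      assms(2) by metis
  define c where "c = (if u 0 = 1 then L 0 else 0)"
  have c: "exp c = 1"
    using L(2)[of 0] by (auto simp: c_def)
  have "power_branch \<beta> u (\<lambda>z. exp (of_real \<beta> * (L z - c)))"
    unfolding power_branch_def
    by (rule exI[of _ "\<lambda>z. L z - c"]) (use L c in \<open>auto intro!: holomorphic_intros simp: exp_diff\<close>)
  then show ?thesis
    by (auto simp: c_def)
qed

lemma power_product_exists:
  assumes "a \<in> dilatations" "a 0 = 0" "lh_factorization f h g"
  shows "\<exists>F. power_product \<alpha> f h g (lh_K a) (lh_k a) F"
proof -
  note K = lh_K_factorization[OF assms(1,2)]
  obtain p where p: "power_branch (1 - \<alpha>) h p"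
    using power_branch_exists[of h "1 - \<alpha>"] assms(3) by (auto simp: lh_factorization_def)
  obtain q where q: "power_branch (1 - \<alpha>) g q" "q 0 = 1"
    using power_branch_exists[of g "1 - \<alpha>"] assms(3) by (auto simp: lh_factorization_def)
  obtain r where r: "power_branch \<alpha> (lh_k a) r" "r 0 = 1"
    using power_branch_exists[of "lh_k a" \<alpha>] K by (auto simp: lh_factorization_def)
  show ?thesis
    unfolding power_product_def
    by (rule exI[of _ "\<lambda>z. z * (p z * r z) * cnj (q z * r z)"]) (use K p q r assms(3) in blast)
qed

lemma power_product_value:
  assumes "power_product \<alpha> f h g K k F" and z: "z \<in> unit_disc" "z \<noteq> 0"
  shows "\<exists>l m. exp l = f z \<and> exp m = K z \<and> F z = exp (of_real (1 - \<alpha>) * l + of_real \<alpha> * m)"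
proof -
  have "\<exists>L M N. exp L = h z \<and> exp M = g z \<and> exp N = k z \<and>
      F z = z * (exp (of_real (1 - \<alpha>) * L) * exp (of_real \<alpha> * N)) *
            cnj (exp (of_real (1 - \<alpha>) * M) * exp (of_real \<alpha> * N))"
    using assms unfolding power_product_def power_branch_def by metis
  then obtain L M N where LMN: "exp L = h z" "exp M = g z" "exp N = k z"
      and F: "F z = z * (exp (of_real (1 - \<alpha>) * L) * exp (of_real \<alpha> * N)) *
            cnj (exp (of_real (1 - \<alpha>) * M) * exp (of_real \<alpha> * N))"
    by blast
  have fK: "f z = z * h z * cnj (g z)" "K z = z * k z * cnj (k z)"
    using assms by (auto simp: power_product_def lh_factorization_def)
  have "F z = exp (Ln z) * (exp (of_real (1 - \<alpha>) * L) * exp (of_real \<alpha> * N)) *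
            (exp (of_real (1 - \<alpha>) * cnj M) * exp (of_real \<alpha> * cnj N))"
    using F z by (simp add: exp_cnj)
  also have "\<dots> = exp (of_real (1 - \<alpha>) * (Ln z + L + cnj M) + of_real \<alpha> * (Ln z + N + cnj N))"
    unfolding exp_add[symmetric] by (rule arg_cong[where f = exp]) (simp add: algebra_simps)
  finally have "F z = exp (of_real (1 - \<alpha>) * (Ln z + L + cnj M) + of_real \<alpha> * (Ln z + N + cnj N))" .
  moreover have "exp (Ln z + L + cnj M) = f z" "exp (Ln z + N + cnj N) = K z"
    using LMN fK z by (simp_all add: exp_add exp_cnj[symmetric])
  ultimately show ?thesis
    by blast
qed

end

theory Submission
  imports Defs
begin

text \<open>
  On the disc \<open>F = z exp(u) cnj(exp(v))\<close> with \<open>z v' = a (1 + z u')\<close>, and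
  \<open>(z F_z - cnj z F_zbar) / F\<close> has the real part of \<open>1 + z u' - z v'\<close>.  For \<open>F\<close> this quantity is
  \<open>1 - \<alpha>\<close> times that of \<open>f\<close> plus \<open>\<alpha>\<close> times that of \<open>K\<close>, and the latter is constantly \<open>1\<close>.

  Univalence is proved in the coordinate \<open>s = log z\<close> on the left half plane.  There
  \<open>log F = G + 2 Re V\<close> with \<open>G(s) = s + u(exp s) - v(exp s)\<close>, \<open>V(s) = v(exp s)\<close> and \<open>Re G' > 0\<close>, so
  \<open>G\<close> is injective.  Since \<open>Im G\<close> increases from \<open>-\<infinity>\<close> to \<open>\<infinity>\<close> along every vertical line, the image of
  \<open>G\<close> meets each horizontal line in an interval, on which the horizontal shear
  \<open>w \<mapsto> w + 2 Re V(G\<inverse>(w))\<close> has derivative \<open>Re ((1 + a) / (1 - a)) > 0\<close>.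
\<close>

section \<open>Wirtinger derivatives of a holomorphic times an antiholomorphic function\<close>

lemma wirtinger_mult_cnj:
  assumes "open S" "z \<in> S" and f: "\<And>w. w \<in> S \<Longrightarrow> f w = A w * cnj (B w)"
    and A: "(A has_field_derivative A') (at z)" and B: "(B has_field_derivative B') (at z)"
  shows "f differentiable (at z)"
    and "wirtinger f z = A' * cnj (B z)"
    and "wirtinger_bar f z = A z * cnj B'"
proof -
  have "((\<lambda>w. A w * cnj (B w)) has_derivative (\<lambda>w. A z * cnj (B' * w) + A' * w * cnj (B z))) (at z)"
    by (intro has_derivative_mult has_derivative_cnj)
      (use A B in \<open>simp_all add: has_field_derivative_def\<close>)
  then have D: "(f has_derivative (\<lambda>w. A z * cnj (B' * w) + A' * w * cnj (B z))) (at z)"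
    by (rule has_derivative_transform_within_open[OF _ assms(1,2)]) (simp add: f)
  show "f differentiable (at z)"
    using D by (rule differentiableI)
  show "wirtinger f z = A' * cnj (B z)" "wirtinger_bar f z = A z * cnj B'"
    unfolding wirtinger_def wirtinger_bar_def frechet_derivative_at[OF D, symmetric]
    by (simp_all add: algebra_simps)
qed

section \<open>Horizontal shears on the left half plane\<close>

abbreviation left_half_plane :: "complex set" where
  "left_half_plane \<equiv> {s. Re s < 0}"

lemma mem_left_half_plane_segment:
  assumes "w \<in> closed_segment s t" "Re s < 0" "Re t < 0"
  shows "Re w < 0"
  using convex_halfspace_Re_lt[of 0] closed_segment_subset[of s left_half_plane t] assms by auto

text \<open>Noshiro-Warschawski criterion. If \<open>G s = G t\<close> with distinct points, the
  mean value theorem for the real part of \<open>G / (t - s)\<close> along the segment produces a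
  point where \<open>Re (G' x) = 0\<close>.\<close>

lemma inj_on_Re_deriv_pos:
  assumes "convex S" and G: "\<And>s. s \<in> S \<Longrightarrow> (G has_field_derivative G' s) (at s)"
    and pos: "\<And>s. s \<in> S \<Longrightarrow> Re (G' s) > 0"
  shows "inj_on G S"
proof (rule inj_onI, rule ccontr)
  fix s t assume st: "s \<in> S" "t \<in> S" "G s = G t" "s \<noteq> t"
  have sub: "closed_segment s t \<subseteq> S"
    using assms(1) st by (simp add: closed_segment_subset)
  have "\<exists>x. x \<in> closed_segment s t \<and>
      Re (G t / (t - s)) - Re (G s / (t - s)) = Re (G' x / (t - s) * (t - s))"
    by (rule complex_mvt_line) (use G sub in \<open>auto intro!: DERIV_cdivide\<close>)
  then show False
    using st pos sub by force
qed

text \<open>On every vertical line \<open>Im G\<close> is strictly increasing, and by periodicity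
  unbounded in both directions, so it takes the value \<open>c\<close> at exactly one height
  \<open>\<tau> x\<close>. The level set \<open>Im G = c\<close> is thus the graph of a function
  \<open>\<tau>\<close>. Once \<open>\<tau>\<close> is continuous, \<open>Re G\<close> maps this
  graph onto an interval.\<close>

lemma horizontal_segment_subset_image:
  assumes G: "\<And>s. Re s < 0 \<Longrightarrow> (G has_field_derivative G' s) (at s)"
    and pos: "\<And>s. Re s < 0 \<Longrightarrow> Re (G' s) > 0"
    and per: "\<And>s n::int. Re s < 0 \<Longrightarrow> G (s + of_real (of_int (2 * n) * pi) * \<i>) = G s + of_real (of_int (2 * n) * pi) * \<i>"
    and s: "Re s1 < 0" "Re s2 < 0" and im: "Im (G s1) = Im (G s2)"
  shows "closed_segment (G s1) (G s2) \<subseteq> G ` left_half_plane"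
proof -
  define c where "c = Im (G s1)"
  have mono: "Im (G (Complex x y1)) < Im (G (Complex x y2))" if "x < 0" "y1 < y2" for x y1 y2
  proof -
    \<comment> \<open>The factor \<open>- \<i>\<close> turns \<open>Im G\<close> into a real part,
      the form in which the mean value theorem is available.\<close>
    have "\<exists>u. u \<in> closed_segment (Complex x y1) (Complex x y2) \<and>
       Re (- \<i> * G (Complex x y2)) - Re (- \<i> * G (Complex x y1))
         = Re ((- \<i> * G' u) * (Complex x y2 - Complex x y1))"
      by (rule complex_mvt_line, rule DERIV_cmult, rule G, erule mem_left_half_plane_segment)
        (use that in auto)
    then obtain u where u: "u \<in> closed_segment (Complex x y1) (Complex x y2)"
      and eq: "Im (G (Complex x y2)) - Im (G (Complex x y1)) = Re (G' u) * (y2 - y1)"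
      by auto
    have "Re (G' u) * (y2 - y1) > 0"
      using pos[of u] mem_left_half_plane_segment[OF u] that by simp
    with eq show ?thesis by simp
  qed
  have contG: "continuous_on left_half_plane G"
    by (rule DERIV_continuous_on, rule DERIV_subset, rule G) auto
  have contx: "continuous_on {..<0} (\<lambda>x. Im (G (Complex x y)))" for y
    by (intro continuous_intros continuous_on_compose2[OF contG] continuous_on_Complex) auto
  have conty: "continuous_on UNIV (\<lambda>y. Im (G (Complex x y)))" if "x < 0" for x
    by (intro continuous_intros continuous_on_compose2[OF contG] continuous_on_Complex)
      (use that in auto)
  have shift: "Im (G (Complex x (2 * of_int n * pi))) = Im (G (Complex x 0)) + 2 * of_int n * pi"
    if "x < 0" for x and n :: int
  proof -
    have "Complex x (2 * of_int n * pi) = Complex x 0 + of_real (of_int (2 * n) * pi) * \<i>"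
      by (simp add: complex_eq_iff)
    then show ?thesis using per[of "Complex x 0" n] that by simp
  qed
  have "\<exists>y. Im (G (Complex x y)) = c" if x: "x < 0" for x
  proof -
    \<comment> \<open>Shifting by \<open>n\<close> periods up or down moves \<open>Im G\<close> by
      at least its distance from \<open>c\<close>, so \<open>c\<close> lies between the two
      values.\<close>
    define n :: int where "n = \<lceil>\<bar>c - Im (G (Complex x 0))\<bar>\<rceil>"
    have n: "of_int n \<ge> \<bar>c - Im (G (Complex x 0))\<bar>" unfolding n_def by linarith
    then have "of_int n * 1 \<le> of_int n * (2 * pi)"
      using pi_gt3 by (intro mult_left_mono) linarith+
    then have "of_int n \<le> 2 * of_int n * pi" by (simp add: mult_ac)
    then have "\<exists>y\<ge>2 * of_int (- n) * pi. y \<le> 2 * of_int n * pi \<and> Im (G (Complex x y)) = c"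
      by (intro IVT') (use n shift[OF x, of n] shift[OF x, of "- n"]
          continuous_on_subset[OF conty[OF x]] in auto)
    then show ?thesis by blast
  qed
  then obtain \<tau> where \<tau>: "\<And>x. x < 0 \<Longrightarrow> Im (G (Complex x (\<tau> x))) = c"
    by metis
  have \<tau>_eq: "\<tau> (Re s) = Im s" if "Re s < 0" "Im (G s) = c" for s
    using mono[of "Re s" "\<tau> (Re s)" "Im s"] mono[of "Re s" "Im s" "\<tau> (Re s)"] \<tau>[of "Re s"] that
    by (cases "\<tau> (Re s)" "Im s" rule: linorder_cases) auto
  \<comment> \<open>For fixed \<open>y\<close>, the sign of \<open>Im (G (Complex x' y)) - c\<close>
    persists for \<open>x'\<close> near \<open>x\<close>, and monotonicity in \<open>y\<close>
    translates that sign into \<open>y < \<tau> x'\<close> or \<open>\<tau> x' < y\<close>.\<close>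
  have "isCont \<tau> x" if x: "x < 0" for x
    unfolding isCont_def
  proof (rule order_tendstoI)
    have ev: "\<forall>\<^sub>F x' in at x. x' < 0"
      using x by (intro order_tendstoD[OF tendsto_ident_at])
    have lim: "((\<lambda>x'. Im (G (Complex x' y))) \<longlongrightarrow> Im (G (Complex x y))) (at x)" for y
      using contx[of y] x by (simp add: continuous_on_eq_continuous_at isCont_def)
    fix y
    {
      assume "y < \<tau> x"
      then have "Im (G (Complex x y)) < c" using mono \<tau> x by metis
      from order_tendstoD(2)[OF lim this] ev show "\<forall>\<^sub>F x' in at x. y < \<tau> x'"
        by eventually_elim (metis mono \<tau> linorder_cases order_less_asym)
    next
      assume "\<tau> x < y"
      then have "c < Im (G (Complex x y))" using mono \<tau> x by metis
      from order_tendstoD(1)[OF lim this] ev show "\<forall>\<^sub>F x' in at x. \<tau> x' < y"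
        by eventually_elim (metis mono \<tau> linorder_cases order_less_asym)
    }
  qed
  then have cont\<tau>: "continuous_on {..<0} \<tau>"
    by (simp add: continuous_on_eq_continuous_at)
  define X where "X = (\<lambda>x. Re (G (Complex x (\<tau> x))))"
  have "continuous_on {..<0} X"
    unfolding X_def
    by (intro continuous_intros continuous_on_compose2[OF contG] continuous_on_Complex cont\<tau>) auto
  then have conn: "connected (X ` {..<0})"
    by (intro connected_continuous_image) auto
  have X: "X (Re s) = Re (G s)" if "Re s < 0" "Im (G s) = c" for s
    using \<tau>_eq[OF that] by (simp add: X_def)
  have mem: "Re (G s1) \<in> X ` {..<0}" "Re (G s2) \<in> X ` {..<0}"
    using X[of s1, symmetric] X[of s2, symmetric] s im by (auto simp: c_def)
  have cs: "closed_segment (Re (G s1)) (Re (G s2)) \<subseteq> X ` {..<0}"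
    using mem conn by (meson closed_segment_subset convex_connected is_interval_connected_1 is_interval_convex_1)
  show ?thesis
  proof
    fix w assume w: "w \<in> closed_segment (G s1) (G s2)"
    have "Im w = c"
      using w closed_segment_same_Im[OF im] by (simp add: c_def)
    moreover have "Re w \<in> X ` {..<0}"
      using w cs closed_segment_same_Im[OF im] by auto
    ultimately show "w \<in> G ` left_half_plane"
      using \<tau> by (force simp: X_def complex_eq_iff)
  qed
qed

text \<open>In the coordinate \<open>w = G s\<close> the map preserves imaginary parts, so two
  points with equal values lie on one horizontal line. The segment between them stays in the image
  of \<open>G\<close>, and the real derivative of the shear along it is positive by
  \<open>shear\<close>.\<close>

lemma inj_on_horizontal_shear:
  assumes G: "\<And>s. Re s < 0 \<Longrightarrow> (G has_field_derivative G' s) (at s)"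
    and pos: "\<And>s. Re s < 0 \<Longrightarrow> Re (G' s) > 0"
    and per: "\<And>s n::int. Re s < 0 \<Longrightarrow> G (s + of_real (of_int (2 * n) * pi) * \<i>) = G s + of_real (of_int (2 * n) * pi) * \<i>"
    and V: "\<And>s. Re s < 0 \<Longrightarrow> (V has_field_derivative V' s) (at s)"
    and shear: "\<And>s. Re s < 0 \<Longrightarrow> Re (1 + 2 * (V' s / G' s)) > 0"
  shows "inj_on (\<lambda>s. G s + of_real (2 * Re (V s))) left_half_plane"
proof (rule inj_onI)
  fix s t
  assume st: "s \<in> left_half_plane" "t \<in> left_half_plane"
    and eq: "G s + of_real (2 * Re (V s)) = G t + of_real (2 * Re (V t))"
  have inj: "inj_on G left_half_plane"
    by (rule inj_on_Re_deriv_pos[of _ G G']) (use G pos convex_halfspace_Re_lt in auto)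
  have opn: "open left_half_plane" by (rule open_halfspace_Re_lt)
  have hol: "G holomorphic_on left_half_plane"
    using G opn by (auto simp: holomorphic_on_open)
  obtain \<psi> where \<psi>: "\<psi> holomorphic_on (G ` left_half_plane)"
      "\<And>s. s \<in> left_half_plane \<Longrightarrow> deriv G s * deriv \<psi> (G s) = 1"
      "\<And>s. s \<in> left_half_plane \<Longrightarrow> \<psi> (G s) = s"
    using holomorphic_has_inverse[OF hol opn inj] by metis
  have opnG: "open (G ` left_half_plane)"
    by (rule open_mapping_thm3[OF hol opn inj])
  have im: "Im (G s) = Im (G t)"
    using arg_cong[OF eq, of Im] by simp
  have seg: "closed_segment (G s) (G t) \<subseteq> G ` left_half_plane"
    by (rule horizontal_segment_subset_image[of G G']) (use G pos per st im in auto)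
  \<comment> \<open>The shear itself is not holomorphic, but this holomorphic function has the same
    real part.\<close>
  have D: "((\<lambda>w. w + 2 * V (\<psi> w)) has_field_derivative 1 + 2 * (V' (\<psi> w) * deriv \<psi> w)) (at w)"
    if "w \<in> G ` left_half_plane" for w
  proof -
    have "Re (\<psi> w) < 0" using that \<psi>(3) by auto
    moreover have "(\<psi> has_field_derivative deriv \<psi> w) (at w)"
      by (rule holomorphic_derivI[OF \<psi>(1) opnG that])
    ultimately show ?thesis
      by (intro DERIV_add DERIV_ident DERIV_cmult DERIV_chain2[OF V])
  qed
  have "\<exists>w. w \<in> closed_segment (G s) (G t) \<and>
      Re (G t + 2 * V (\<psi> (G t))) - Re (G s + 2 * V (\<psi> (G s)))
        = Re ((1 + 2 * (V' (\<psi> w) * deriv \<psi> w)) * (G t - G s))"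
    by (rule complex_mvt_line) (use D seg in blast)
  then obtain w where w: "w \<in> closed_segment (G s) (G t)"
    and w_eq: "Re (G t + 2 * V (\<psi> (G t))) - Re (G s + 2 * V (\<psi> (G s)))
        = Re ((1 + 2 * (V' (\<psi> w) * deriv \<psi> w)) * (G t - G s))" by blast
  obtain r where r: "w = G r" "Re r < 0" using w seg by auto
  have "deriv \<psi> w = 1 / G' r"
    using \<psi>(2)[of r] r DERIV_imp_deriv[OF G[OF r(2)]] by (auto simp: divide_simps mult.commute)
  then have *: "Re (1 + 2 * (V' (\<psi> w) * deriv \<psi> w)) > 0"
    using shear[OF r(2)] \<psi>(3)[of r] r by simp
  have "Re (G t + 2 * V (\<psi> (G t))) = Re (G s + 2 * V (\<psi> (G s)))"
    using arg_cong[OF eq, of Re] \<psi>(3)[OF st(1)] \<psi>(3)[OF st(2)] by simp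
  \<comment> \<open>\<open>G t - G s\<close> is real, so the real part of the product
    factors.\<close>
  then have "Re (1 + 2 * (V' (\<psi> w) * deriv \<psi> w)) * (Re (G t) - Re (G s)) = 0"
    using w_eq im by simp
  then have "Re (G t) = Re (G s)"
    using * by (metis less_irrefl mult_eq_0_iff right_minus_eq)
  then have "G s = G t"
    using im by (simp add: complex_eq_iff)
  then show "s = t"
    using inj st by (meson inj_onD)
qed

section \<open>Starlike logharmonic mappings in exponential form\<close>

text \<open>The expression equals \<open>(1 + a) / (1 - a)\<close>, the Cayley transform from the
  unit disc to the right half plane.\<close>

lemma Re_Cayley_pos:
  assumes "cmod a < 1"
  shows "Re (1 + 2 * (a / (1 - a))) > 0"
proof -
  have ne: "1 - a \<noteq> 0" using assms by auto
  have "1 + 2 * (a / (1 - a)) = (1 + a) / (1 - a)"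
    using ne by (simp add: field_simps)
  also have "Re \<dots> = (1 - (cmod a)\<^sup>2) / (cmod (1 - a))\<^sup>2"
    unfolding Re_divide cmod_power2 by (simp add: algebra_simps power2_eq_square)
  also have "\<dots> > 0"
    using ne assms by (intro divide_pos_pos) (auto simp: abs_square_less_1)
  finally show ?thesis .
qed

lemma exp_mem_unit_disc_iff: "exp s \<in> unit_disc \<longleftrightarrow> Re s < 0"
  by simp

text \<open>Lifts \<open>F\<close> through \<open>exp\<close> to the shear \<open>L\<close>. Equal
  nonzero values of \<open>F\<close> give lifts differing by a multiple of \<open>2 pi i\<close>;
  translating one preimage by that multiple changes \<open>L\<close> equally and leaves
  \<open>exp\<close> unchanged, so injectivity of \<open>L\<close> suffices.\<close>

lemma inj_on_exp_form:
  assumes u: "\<And>z. z \<in> unit_disc \<Longrightarrow> (u has_field_derivative u' z) (at z)"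
    and v: "\<And>z. z \<in> unit_disc \<Longrightarrow> (v has_field_derivative v' z) (at z)"
    and a: "\<And>z. z \<in> unit_disc \<Longrightarrow> cmod (a z) < 1"
    and dil: "\<And>z. z \<in> unit_disc \<Longrightarrow> z * v' z = a z * (1 + z * u' z)"
    and pos: "\<And>z. z \<in> unit_disc - {0} \<Longrightarrow> Re (1 + z * u' z - z * v' z) > 0"
    and F: "\<forall>z\<in>unit_disc. F z = z * exp (u z) * cnj (exp (v z))"
  shows "inj_on F unit_disc"
proof (rule inj_onI)
  define G where "G = (\<lambda>s. s + u (exp s) - v (exp s))"
  define V where "V = (\<lambda>s. v (exp s))"
  define L where "L = (\<lambda>s. G s + of_real (2 * Re (V s)))"
  have DG: "(G has_field_derivative 1 + u' (exp s) * exp s - v' (exp s) * exp s) (at s)"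
    if "Re s < 0" for s
    unfolding G_def using that
    by (intro derivative_intros DERIV_chain2[OF u] DERIV_chain2[OF v] DERIV_exp) auto
  have DV: "(V has_field_derivative v' (exp s) * exp s) (at s)" if "Re s < 0" for s
    unfolding V_def using that
    by (intro DERIV_chain2[OF v] DERIV_exp) auto
  have "inj_on (\<lambda>s. G s + of_real (2 * Re (V s))) left_half_plane"
  proof (rule inj_on_horizontal_shear)
    fix s :: complex assume s: "Re s < 0"
    have e: "exp s \<in> unit_disc - {0}" using s by simp
    show pG: "Re (1 + u' (exp s) * exp s - v' (exp s) * exp s) > 0"
      using pos[OF e] by (simp add: mult.commute)
    \<comment> \<open>The dilatation relation factors \<open>G'\<close>; hence
      \<open>V' / G'\<close> becomes \<open>a / (1 - a)\<close>, and the shear condition is the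
      Cayley estimate.\<close>
    have P: "1 + u' (exp s) * exp s - v' (exp s) * exp s
        = (1 - a (exp s)) * (1 + exp s * u' (exp s))"
      using dil[of "exp s"] e by (simp add: algebra_simps)
    have "1 + exp s * u' (exp s) \<noteq> 0"
    proof
      assume "1 + exp s * u' (exp s) = 0"
      then have "1 + u' (exp s) * exp s - v' (exp s) * exp s = 0"
        unfolding P by simp
      with pG show False by (simp only: zero_complex.sel less_irrefl)
    qed
    then have "v' (exp s) * exp s / (1 + u' (exp s) * exp s - v' (exp s) * exp s)
        = a (exp s) / (1 - a (exp s))"
      unfolding P using dil[of "exp s"] e by (simp add: mult.commute)
    then show "Re (1 + 2 * (v' (exp s) * exp s /
        (1 + u' (exp s) * exp s - v' (exp s) * exp s))) > 0"
      using Re_Cayley_pos[OF a, of "exp s"] e by simp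
    show "G (s + of_real (of_int (2 * n) * pi) * \<i>) = G s + of_real (of_int (2 * n) * pi) * \<i>"
      for n :: int
    proof -
      have "exp (s + of_real (of_int (2 * n) * pi) * \<i>) = exp s"
        unfolding exp_eq by (rule exI[of _ n]) simp
      then show ?thesis by (simp add: G_def)
    qed
  qed (fact DG DV)+
  then have inj: "inj_on L left_half_plane" by (simp add: L_def)
  have FL: "F (exp s) = exp (L s)" if "Re s < 0" for s
  proof -
    \<comment> \<open>Adding \<open>2 Re v\<close> to \<open>- v\<close> gives
      \<open>cnj v\<close>.\<close>
    have "L s = s + u (exp s) + cnj (v (exp s))"
      by (simp add: L_def G_def V_def complex_eq_iff)
    then show ?thesis
      using bspec[OF F, of "exp s"] that by (simp add: exp_add exp_cnj)
  qed
  have F0: "F z = 0 \<longleftrightarrow> z = 0" if "z \<in> unit_disc" for z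
    using bspec[OF F that] by simp
  fix z w assume zw: "z \<in> unit_disc" "w \<in> unit_disc" "F z = F w"
  show "z = w"
  proof (cases "z = 0 \<or> w = 0")
    case True
    then show ?thesis using F0 zw by metis
  next
    case False
    then have ne: "z \<noteq> 0" "w \<noteq> 0" by auto
    define s where "s = Ln z"
    define t where "t = Ln w"
    have st: "exp s = z" "exp t = w" using ne by (simp_all add: s_def t_def)
    have neg: "Re s < 0" "Re t < 0"
      using zw st exp_mem_unit_disc_iff by metis+
    have "exp (L s) = exp (L t)" using FL neg st zw(3) by metis
    then obtain n :: int where n: "L s = L t + of_real (of_int (2 * n) * pi) * \<i>"
      unfolding exp_eq by blast
    define t' where "t' = t + of_real (of_int (2 * n) * pi) * \<i>"
    have et': "exp t' = exp t" unfolding t'_def exp_eq by (rule exI[of _ n]) simp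
    have "L t' = L s"
      unfolding n by (simp add: L_def G_def V_def et') (simp add: t'_def)
    moreover have "Re t' < 0" using neg by (simp add: t'_def)
    ultimately have "t' = s" using inj neg by (auto dest: inj_onD)
    then show ?thesis using et' st by simp
  qed
qed

text \<open>Formally \<open>log F = log z + u + cnj v\<close>, whose holomorphic and antiholomorphic
  parts give the two logarithmic derivatives.\<close>

lemma wirtinger_exp_form:
  assumes u: "(u has_field_derivative u') (at z)" and v: "(v has_field_derivative v') (at z)"
    and F: "\<forall>z\<in>unit_disc. F z = z * exp (u z) * cnj (exp (v z))"
    and z: "z \<in> unit_disc"
  shows "F differentiable (at z)"
    and "z \<noteq> 0 \<Longrightarrow> wirtinger F z / F z = 1 / z + u'"
    and "z \<noteq> 0 \<Longrightarrow> wirtinger_bar F z / F z = cnj v'"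
proof -
  have A: "((\<lambda>z. z * exp (u z)) has_field_derivative exp (u z) * (1 + z * u')) (at z)"
    by (rule derivative_eq_intros u refl)+ (simp add: algebra_simps)
  have B: "((\<lambda>z. exp (v z)) has_field_derivative exp (v z) * v') (at z)"
    by (rule derivative_eq_intros v refl)+
  note W = wirtinger_mult_cnj[OF open_ball z bspec[OF F] A B]
  show "F differentiable (at z)" by (rule W)
  show "wirtinger F z / F z = 1 / z + u'" if "z \<noteq> 0"
    using that bspec[OF F z] W by (simp add: field_simps)
  show "wirtinger_bar F z / F z = cnj v'" if "z \<noteq> 0"
    using that bspec[OF F z] W by (simp add: field_simps)
qed

lemma Re_starlike_quotient:
  assumes "z \<noteq> 0" "W / f = 1 / z + u'" "W_bar / f = cnj v'"
  shows "Re ((z * W - cnj z * W_bar) / f) = Re (1 + z * u' - z * v')"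
proof -
  have "(z * W - cnj z * W_bar) / f = z * (W / f) - cnj z * (W_bar / f)"
    by (simp add: diff_divide_distrib)
  also have "\<dots> = 1 + z * u' - cnj (z * v')"
    using assms by (simp add: field_simps)
  finally show ?thesis by simp
qed

text \<open>Reduces membership to two conditions on \<open>u'\<close> and \<open>v'\<close>: an
  affine relation and a real part estimate, both of which survive the weighted averaging of
  exponents in the power product.\<close>

lemma exp_form_in_ST_Lh:
  assumes "0 \<le> \<alpha>" and a: "a \<in> dilatations"
    and u: "\<And>z. z \<in> unit_disc \<Longrightarrow> (u has_field_derivative u' z) (at z)"
    and v: "\<And>z. z \<in> unit_disc \<Longrightarrow> (v has_field_derivative v' z) (at z)"
    and v0: "exp (v 0) = 1"
    and dil: "\<And>z. z \<in> unit_disc \<Longrightarrow> z * v' z = a z * (1 + z * u' z)"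
    and pos: "\<And>z. z \<in> unit_disc - {0} \<Longrightarrow> \<alpha> < Re (1 + z * u' z - z * v' z)"
    and F: "\<forall>z\<in>unit_disc. F z = z * exp (u z) * cnj (exp (v z))"
  shows "F \<in> ST_Lh \<alpha>"
proof -
  note W = wirtinger_exp_form[OF u v F]
  have "inj_on F unit_disc"
  proof (rule inj_on_exp_form[OF u v _ dil _ F])
    show "cmod (a z) < 1" if "z \<in> unit_disc" for z
      using a that by (simp add: dilatations_def)
    show "Re (1 + z * u' z - z * v' z) > 0" if "z \<in> unit_disc - {0}" for z
      using pos[OF that] assms(1) by linarith
  qed
  moreover have "logharmonic a F"
    unfolding logharmonic_def
  proof (intro conjI ballI impI)
    fix z assume z: "z \<in> unit_disc"
    then show "F differentiable (at z)" by (intro W(1))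
    assume "F z \<noteq> 0"
    then have ne: "z \<noteq> 0" using F z by auto
    have "cnj (wirtinger_bar F z) / cnj (F z) = v' z"
      using arg_cong[OF W(3)[OF z z z ne], of cnj] by simp
    moreover have "v' z = a z * (1 / z + u' z)"
      using dil[OF z] ne by (simp add: field_simps)
    ultimately show "cnj (wirtinger_bar F z) / cnj (F z) = a z * (wirtinger F z / F z)"
      using W(2)[OF z z z ne] by simp
  qed
  moreover have "lh_factorization F (\<lambda>z. exp (u z)) (\<lambda>z. exp (v z))"
  proof -
    have "u holomorphic_on unit_disc" "v holomorphic_on unit_disc"
      using u v unfolding holomorphic_on_open[OF open_ball] by blast+
    then show ?thesis
      using F v0 by (auto simp: lh_factorization_def intro!: holomorphic_intros)
  qed
  moreover have "\<alpha> < Re ((z * wirtinger F z - cnj z * wirtinger_bar F z) / F z)"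
    if z: "z \<in> unit_disc - {0}" for z
  proof -
    have z': "z \<in> unit_disc" "z \<noteq> 0" using z by auto
    show ?thesis
      using pos[OF z] Re_starlike_quotient[OF z'(2) W(2,3)[OF z'(1,1,1,2)]] by simp
  qed
  ultimately show ?thesis
    using a unfolding ST_Lh_def by blast
qed

section \<open>Derivatives of the integral and of logarithm branches\<close>

text \<open>Since \<open>a 0 = 0\<close>, the quotient \<open>a z / z\<close> extends
  holomorphically to the origin, and the integrand has a primitive on the disc. The relation is
  multiplied by \<open>z\<close> so that it also holds at the origin.\<close>

lemma has_field_derivative_lh_integral:
  assumes a: "a \<in> dilatations" and a0: "a 0 = 0"
  shows "\<exists>q'. \<forall>z\<in>unit_disc. (lh_integral a has_field_derivative q' z) (at z) \<and>
           z * q' z = a z / (1 - a z)"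
proof -
  define q where "q = (\<lambda>z. if z = 0 then deriv a 0 else a z / z)"
  have hol: "a holomorphic_on unit_disc" and lt: "\<And>z. z \<in> unit_disc \<Longrightarrow> cmod (a z) < 1"
    using a by (auto simp: dilatations_def)
  have q: "q holomorphic_on unit_disc"
    by (rule pole_theorem_open_0[OF hol, of 0]) (auto simp: q_def a0)
  have ne: "1 - a z \<noteq> 0" if "z \<in> unit_disc" for z
    using lt[OF that] by auto
  have "(\<lambda>z. q z / (1 - a z)) holomorphic_on unit_disc"
    by (intro holomorphic_intros q hol ne)
  then obtain G where G: "\<And>x. x \<in> unit_disc \<Longrightarrow>
      (G has_field_derivative q x / (1 - a x)) (at x within unit_disc)"
    using holomorphic_convex_primitive'[of unit_disc] by auto
  have eq: "lh_integral a z = G z - G 0" if z: "z \<in> unit_disc" for z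
  proof -
    have sub: "path_image (linepath 0 z) \<subseteq> unit_disc"
      using z closed_segment_subset[of 0 unit_disc z] by simp
    have "lh_integral a z = contour_integral (linepath 0 z) (\<lambda>s. q s / (1 - a s))"
    \<comment> \<open>The integrands differ only at the origin; the path is simple only for nonzero
      \<open>z\<close>.\<close>
    proof (cases "z = 0")
      case False
      then show ?thesis
        unfolding lh_integral_def
        by (intro contour_integral_spike_finite_simple_path[of "{0}"])
          (auto simp: q_def mult.commute)
    qed (simp add: lh_integral_def)
    also have "\<dots> = G z - G 0"
      using contour_integral_primitive[OF G _ sub] by (simp add: contour_integral_unique)
    finally show ?thesis .
  qed
  have "(lh_integral a has_field_derivative q z / (1 - a z)) (at z)" if z: "z \<in> unit_disc" for z
  proof -
    have "(G has_field_derivative q z / (1 - a z)) (at z)"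
      using G[OF z] at_within_open[OF z open_ball] by simp
    then have "((\<lambda>z. G z - G 0) has_field_derivative q z / (1 - a z)) (at z)"
      by (auto intro!: derivative_eq_intros)
    then show ?thesis
      by (rule has_field_derivative_transform_within_open[OF _ open_ball z]) (simp add: eq)
  qed
  then show ?thesis
    by (intro exI[of _ "\<lambda>z. q z / (1 - a z)"]) (auto simp: q_def a0)
qed

text \<open>Two logarithms of one function may differ by periods, but differentiating the
  exponentials and cancelling the common nonzero factor identifies their derivatives. This links an
  arbitrary logarithm of \<open>lh_k a\<close> to \<open>lh_integral a\<close>.\<close>

lemma log_branch_has_field_derivative:
  assumes "L holomorphic_on S" "open S" "z \<in> S" "\<And>w. w \<in> S \<Longrightarrow> exp (L w) = exp (M w)"
    and "(M has_field_derivative M') (at z)"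
  shows "(L has_field_derivative M') (at z)"
proof -
  have L: "(L has_field_derivative deriv L z) (at z)"
    using assms holomorphic_derivI by blast
  have "((\<lambda>w. exp (L w)) has_field_derivative exp (L z) * deriv L z) (at z)"
    by (rule derivative_eq_intros L refl)+
  moreover have "((\<lambda>w. exp (M w)) has_field_derivative exp (M z) * M') (at z)"
    by (rule derivative_eq_intros assms(5) refl)+
  then have "((\<lambda>w. exp (L w)) has_field_derivative exp (M z) * M') (at z)"
    by (rule has_field_derivative_transform_within_open[OF _ assms(2,3)]) (simp add: assms(4))
  ultimately have "exp (L z) * deriv L z = exp (M z) * M'"
    by (rule DERIV_unique)
  then show ?thesis
    using L assms(3,4) by simp
qed

text \<open>At the origin the relation says \<open>a 0 = 0\<close>; there it follows by continuity, because the
  quotients in the definition of logharmonicity are only meaningful off the zeros of \<open>f\<close>.\<close>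

lemma logharmonic_exp_form_dilatation:
  assumes a: "a holomorphic_on unit_disc" and "logharmonic a f"
    and u: "u holomorphic_on unit_disc" and v: "v holomorphic_on unit_disc"
    and f: "\<forall>z\<in>unit_disc. f z = z * exp (u z) * cnj (exp (v z))"
    and z: "z \<in> unit_disc"
  shows "z * deriv v z = a z * (1 + z * deriv u z)"
proof -
  define d where "d = (\<lambda>z. z * deriv v z - a z * (1 + z * deriv u z))"
  have d: "d w = 0" if w: "w \<in> unit_disc - {0}" for w
  proof -
    have w': "w \<in> unit_disc" "w \<noteq> 0" using w by auto
    note W = wirtinger_exp_form[OF holomorphic_derivI[OF u open_ball w'(1)]
        holomorphic_derivI[OF v open_ball w'(1)] f w'(1)]
    have "f w \<noteq> 0" using f w' by simp
    then have "cnj (wirtinger_bar f w / f w) = a w * (wirtinger f w / f w)"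
      using assms(2) w' by (simp add: logharmonic_def)
    then have "deriv v w = a w * (1 / w + deriv u w)"
      using W(2,3) w' by simp
    then show ?thesis
      using w' by (simp add: d_def field_simps)
  qed
  have hol: "d holomorphic_on unit_disc"
    unfolding d_def by (intro holomorphic_intros a u v open_ball)
  then have "isCont d 0"
    using holomorphic_on_imp_continuous_on continuous_on_interior[of unit_disc d 0] by auto
  then have "(d \<longlongrightarrow> d 0) (at 0)" by (simp add: isCont_def)
  moreover have "\<forall>\<^sub>F w in at 0. d w = 0"
    using eventually_at_ball'[of 1 0 UNIV] by (rule eventually_mono) (use d in auto)
  then have "(d \<longlongrightarrow> 0) (at 0)" by (rule tendsto_eventually)
  ultimately have "d 0 = 0"
    using tendsto_unique[of "at (0::complex)"] by auto
  then have "d z = 0" using d z by (cases "z = 0") auto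
  then show ?thesis by (simp add: d_def)
qed

theorem proposition2:
  fixes \<alpha> :: real and a f h g F :: "complex \<Rightarrow> complex"
  assumes "0 \<le> \<alpha>" and "\<alpha> < 1"
    and "a \<in> dilatations"
    and "f \<in> ST_Lh 0"
    and "lh_factorization f h g"
    and "logharmonic a f"
    and "power_product \<alpha> f h g (lh_K a) (lh_k a) F"
  shows "F \<in> ST_Lh \<alpha>"
proof -
  obtain p q r where p: "power_branch (1 - \<alpha>) h p"
    and q: "power_branch (1 - \<alpha>) g q" "q 0 = 1"
    and r: "power_branch \<alpha> (lh_k a) r" "r 0 = 1"
    and F: "\<And>z. z \<in> unit_disc \<Longrightarrow> F z = z * (p z * r z) * cnj (q z * r z)"
    using assms(7) unfolding power_product_def by metis
  from p obtain u where u: "u holomorphic_on unit_disc"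
      "\<And>z. z \<in> unit_disc \<Longrightarrow> exp (u z) = h z"
      "\<And>z. z \<in> unit_disc \<Longrightarrow> p z = exp (of_real (1 - \<alpha>) * u z)"
    unfolding power_branch_def by metis
  from q obtain v where v: "v holomorphic_on unit_disc"
      "\<And>z. z \<in> unit_disc \<Longrightarrow> exp (v z) = g z"
      "\<And>z. z \<in> unit_disc \<Longrightarrow> q z = exp (of_real (1 - \<alpha>) * v z)"
    unfolding power_branch_def by metis
  from r obtain k where k: "k holomorphic_on unit_disc"
      "\<And>z. z \<in> unit_disc \<Longrightarrow> exp (k z) = lh_k a z"
      "\<And>z. z \<in> unit_disc \<Longrightarrow> r z = exp (of_real \<alpha> * k z)"
    unfolding power_branch_def by metis
  have a: "a holomorphic_on unit_disc" "\<And>z. z \<in> unit_disc \<Longrightarrow> cmod (a z) < 1"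
    using assms(3) by (auto simp: dilatations_def)
  have f: "\<forall>z\<in>unit_disc. f z = z * exp (u z) * cnj (exp (v z))"
    using assms(5) u(2) v(2) by (simp add: lh_factorization_def)
  note dil = logharmonic_exp_form_dilatation[OF a(1) assms(6) u(1) v(1) f]
  \<comment> \<open>At the origin the relation reads \<open>0 = a 0\<close>.\<close>
  have a0: "a 0 = 0" using dil[of 0] by simp
  obtain k' where k'_int: "\<And>z. z \<in> unit_disc \<Longrightarrow> (lh_integral a has_field_derivative k' z) (at z)"
    and k': "\<And>z. z \<in> unit_disc \<Longrightarrow> z * k' z = a z / (1 - a z)"
    using has_field_derivative_lh_integral[OF assms(3) a0] by metis
  have Dk: "(k has_field_derivative k' z) (at z)" if "z \<in> unit_disc" for z
    by (rule log_branch_has_field_derivative[OF k(1) open_ball that _ k'_int[OF that]])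
      (simp add: k(2) lh_k_def)
  have Du: "(u has_field_derivative deriv u z) (at z)"
    and Dv: "(v has_field_derivative deriv v z) (at z)" if "z \<in> unit_disc" for z
    using u(1) v(1) that holomorphic_derivI[OF _ open_ball] by blast+
  \<comment> \<open>Exponents \<open>1 - \<alpha>\<close> and \<open>\<alpha>\<close> sum to
    \<open>1\<close>, so the affine dilatation relation passes from \<open>f\<close> and
    \<open>K\<close> to \<open>F\<close>.\<close>
  define b where "b = complex_of_real (1 - \<alpha>)"
  define c where "c = complex_of_real \<alpha>"
  have bc: "b + c = 1" by (simp add: b_def c_def)
  show ?thesis
  proof (rule exp_form_in_ST_Lh[OF assms(1,3)])
    show "((\<lambda>z. b * u z + c * k z) has_field_derivative b * deriv u z + c * k' z) (at z)"
      and "((\<lambda>z. b * v z + c * k z) has_field_derivative b * deriv v z + c * k' z) (at z)"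
      if "z \<in> unit_disc" for z
      by (intro DERIV_add DERIV_cmult Du Dv Dk that)+
    show "exp (b * v 0 + c * k 0) = 1"
      using v(3)[of 0] k(3)[of 0] q(2) r(2) by (simp add: exp_add b_def c_def)
    show "\<forall>z\<in>unit_disc. F z = z * exp (b * u z + c * k z) * cnj (exp (b * v z + c * k z))"
      using F u(3) v(3) k(3)
      by (simp add: exp_add b_def c_def)
    show "z * (b * deriv v z + c * k' z) = a z * (1 + z * (b * deriv u z + c * k' z))"
      if z: "z \<in> unit_disc" for z
    proof -
      have "1 - a z \<noteq> 0" using a(2)[OF z] by auto
      \<comment> \<open>\<open>K\<close> has the same dilatation as \<open>f\<close>: its relation
        with \<open>u = v = k\<close> is \<open>a / (1 - a) = a (1 + a / (1 - a))\<close>.\<close>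
      then have kz: "z * k' z = a z * (1 + z * k' z)"
        by (simp add: k'[OF z] field_simps)
      have "z * (b * deriv v z + c * k' z) = b * (z * deriv v z) + c * (z * k' z)"
        by (simp add: algebra_simps)
      also have "\<dots> = b * (a z * (1 + z * deriv u z)) + c * (a z * (1 + z * k' z))"
        using dil[OF z] kz by simp
      also have "\<dots> = a z * ((b + c) + z * (b * deriv u z + c * k' z))"
        by (simp add: algebra_simps)
      finally show ?thesis by (simp add: bc)
    qed
    show "\<alpha> < Re (1 + z * (b * deriv u z + c * k' z) - z * (b * deriv v z + c * k' z))"
      if z: "z \<in> unit_disc - {0}" for z
    proof -
      have z': "z \<in> unit_disc" "z \<noteq> 0" using z by auto
      note W = wirtinger_exp_form[OF Du[OF z'(1)] Dv[OF z'(1)] f z'(1)]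
      have "Re ((z * wirtinger f z - cnj z * wirtinger_bar f z) / f z) > 0"
        using assms(4) z by (auto simp: ST_Lh_def)
      then have *: "Re (1 + z * deriv u z - z * deriv v z) > 0"
        using Re_starlike_quotient[OF z'(2) W(2,3)[OF z'(2)]] by simp
      \<comment> \<open>The terms with \<open>k'\<close> cancel because \<open>k\<close> enters both
        factors of \<open>K\<close>; what remains of \<open>K\<close> is the summand
        \<open>\<alpha>\<close>.\<close>
      have "1 + z * (b * deriv u z + c * k' z) - z * (b * deriv v z + c * k' z)
          = of_real (1 - \<alpha>) * (1 + z * deriv u z - z * deriv v z) + of_real \<alpha>"
        by (simp add: b_def c_def algebra_simps)
      also have "Re \<dots> = (1 - \<alpha>) * Re (1 + z * deriv u z - z * deriv v z) + \<alpha>"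
        unfolding plus_complex.sel Re_complex_of_real times_complex.sel by simp
      also have "\<dots> > \<alpha>"
        using * assms(2) by (simp only: less_add_same_cancel2 mult_pos_pos diff_gt_0_iff_gt)
      finally show ?thesis .
    qed
  qed
qed

end
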